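(* Let $f:\mathbb{R}^n\to\mathbb{R}$ be differentiable, $\mu$-strongly convex and with $L$-Lipschitz continuous gradient, where $0<\mu<L<+\infty$, and let $\mathbf{x}^*$ be its minimizer. Let $\mathbf{R}\in\mathbb{R}^{n_\ell\times n}$ and $\mathbf{P}\in\mathbb{R}^{n\times n_\ell}$, $n_\ell<n$, satisfy $\mathbf{P}=\mathbf{R}^T$ and $\operatorname{rank}(\mathbf{P})=n_\ell$. Let $m>0$ and $r\ge 1$ with $r+1\le n$. Let $(\mathbf{x}_k)_{k\ge 0}$ be generated from $\mathbf{x}_0\in\mathbb{R}^n$ by $$\mathbf{x}_{k+1}=\mathbf{x}_k+\frac{m}{L\sqrt{M}}\,\mathbf{d}_k,\qquad \mathbf{d}_k:=-\mathbf{Q}_k^{-\frac12}\nabla f(\mathbf{x}_k),$$ where $\mathbf{Q}_k^{-\frac12}$ is the truncated and modified inverse square root preconditioner (with parameters $m,r$) defined in the context, and $M\ge m$ is a constant such that $m\mathbf{I}\preceq\mathbf{Q}_k\preceq M\mathbf{I}$ for all $k$, with $\mathbf{Q}_k$ here denoting the positive definite matrix whose inverse square root is $\mathbf{Q}_k^{-\frac12}$. Then there exists $c\in(0,1)$ such that for all $k\ge 0$ $$f(\mathbf{x}_{k+1})-f(\mathbf{x}^* )\le c\,\bigl(f(\mathbf{x}_k)-f(\mathbf{x}^* )\bigr).$$ Moreover, for every $\epsilon>0$, at most $$K=\frac{\log\bigl((f(\mathbf{x}_0)-f(\mathbf{x}^* ))/\epsilon\bigr)}{\log(1/c)}$$ iterations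 are required to reach accuracy $\epsilon$, i.e. $f(\mathbf{x}_k)-f(\mathbf{x}^* )\le\epsilon$ for every integer $k\ge\max(0,K)$ (with the convention $\log 0=-\infty$).
   Context: Lipschitz gradient: $\|\nabla f(\mathbf{y})-\nabla f(\mathbf{x})\|_2\le L\|\mathbf{y}-\mathbf{x}\|_2$ for all $\mathbf{x},\mathbf{y}\in\mathbb{R}^n$. Strong convexity: $f(\mathbf{y})\ge f(\mathbf{x})+\langle\nabla f(\mathbf{x}),\mathbf{y}-\mathbf{x}\rangle+\frac{\mu}{2}\|\mathbf{y}-\mathbf{x}\|_2^2$ for all $\mathbf{x},\mathbf{y}\in\mathbb{R}^n$. $\|\cdot\|_2$ is the Euclidean norm. Construction of $\mathbf{Q}_k^{-1/2}$: form the symmetric positive semidefinite $n\times n$ matrix $\nabla f(\mathbf{x}_k)\nabla f(\mathbf{x}_k)^T$. Let $\lambda_1\ge\lambda_2\ge\dots\ge\lambda_{r+1}\ge 0$ be its $r+1$ largest eigenvalues, with corresponding orthonormal eigenvectors, and let $\mathbf{U}_r\in\mathbb{R}^{n\times r}$ be the matrix whose columns are the first $r$ of these eigenvectors. Set $\tilde\lambda_i:=\lambda_i$ if $\lambda_i\ge m$ and $\tilde\lambda_i:=m$ otherwise, for $i=1,\dots,r+1$. Then $$\mathbf{Q}_k^{-\frac12}:=\tilde\lambda_{r+1}^{-\frac12}\,\mathbf{I}_n+\mathbf{U}_r\Bigl(\operatorname{diag}(\tilde\lambda_1^{-\frac12},\dots,\tilde\lambda_r^{-\frac12})-\tilde\lambda_{r+1}^{-\frac12}\,\mathbf{I}_r\Bigr)\mathbf{U}_r^T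 .$$ The operators $\mathbf{R}$ and $\mathbf{P}$ (restriction and prolongation) do not enter the iteration; they are part of the paper's hypotheses. *)

theory Defs
  imports "HOL-Analysis.Analysis" "HOL-Library.Extended_Real" "HOL-Library.Countable_Set"
begin

definition strongly_convex ::
    "real \<Rightarrow> ('a::real_inner \<Rightarrow> real) \<Rightarrow> ('a \<Rightarrow> 'a) \<Rightarrow> bool" where
  "strongly_convex \<mu> f grad \<longleftrightarrow>
     (\<forall>x y. f y \<ge> f x + grad x \<bullet> (y - x) + \<mu> / 2 * (norm (y - x))\<^sup>2)"

definition pos_semidef :: "real^'n^'n \<Rightarrow> bool" where
  "pos_semidef A \<longleftrightarrow> transpose A = A \<and> (\<forall>v. 0 \<le> v \<bullet> (A *v v))"

definition pos_def :: "real^'n^'n \<Rightarrow> bool" where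
  "pos_def A \<longleftrightarrow> transpose A = A \<and> (\<forall>v. v \<noteq> 0 \<longrightarrow> 0 < v \<bullet> (A *v v))"

definition loewner_le :: "real^'n^'n \<Rightarrow> real^'n^'n \<Rightarrow> bool" (infix \<open>\<preceq>\<^sub>L\<close> 50) where
  "A \<preceq>\<^sub>L B \<longleftrightarrow> pos_semidef (B - A)"

definition outer_square :: "real^'n \<Rightarrow> real^'n^'n" where
  "outer_square g = (columnvector g :: real^1^'n) ** transpose (columnvector g :: real^1^'n)"

definition diag_mat :: "('r \<Rightarrow> real) \<Rightarrow> real^'r^'r" where
  "diag_mat d = (\<chi> i j. if i = j then d i else 0)"

text \<open>An orthonormal basis \<open>u 1, \<dots>, u n\<close> of eigenvectors, with eigenvalues
  \<open>lam 1 \<ge> \<dots> \<ge> lam n\<close> repeated according to multiplicity. Only the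
  indices \<open>1, \<dots>, n\<close> are meaningful. Ties leave the choice of \<open>u\<close> free, hence
  a relation rather than a function.\<close>

definition ordered_eigensystem ::
    "real^'n^'n \<Rightarrow> (nat \<Rightarrow> real) \<Rightarrow> (nat \<Rightarrow> real^'n) \<Rightarrow> bool" where
  "ordered_eigensystem A lam u \<longleftrightarrow>
     (\<forall>i\<in>{1..CARD('n)}. A *v u i = lam i *\<^sub>R u i) \<and>
     (\<forall>i\<in>{1..CARD('n)}. \<forall>j\<in>{1..CARD('n)}. u i \<bullet> u j = (if i = j then 1 else 0)) \<and>
     (\<forall>i\<in>{1..CARD('n)}. \<forall>j\<in>{1..CARD('n)}. i \<le> j \<longrightarrow> lam j \<le> lam i)"

text \<open>The number \<open>r\<close> of columns of \<open>U\<close> is the cardinality of the index type \<open>'r\<close>, whose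
  elements are numbered \<open>1, \<dots>, r\<close> by a fixed bijection. The order of the columns is
  immaterial in \<open>inv_sqrt_precond\<close>, as the diagonal factor uses the same numbering.\<close>

definition col_no :: "'r::finite \<Rightarrow> nat" where
  "col_no j = Suc (to_nat_on (UNIV :: 'r set) j)"

lemma bij_betw_col_no: "bij_betw (col_no :: 'r::finite \<Rightarrow> nat) UNIV {1..CARD('r)}"
proof -
  have "bij_betw (to_nat_on (UNIV :: 'r set)) UNIV {..<CARD('r)}"
    by (simp add: to_nat_on_finite)
  moreover have "bij_betw Suc {..<CARD('r)} {1..CARD('r)}"
    by (auto simp: bij_betw_def image_Suc_lessThan)
  ultimately have "bij_betw (Suc \<circ> to_nat_on (UNIV :: 'r set)) UNIV {1..CARD('r)}"
    by (rule bij_betw_trans)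
  then show ?thesis
    by (simp add: bij_betw_def inj_on_def image_def col_no_def)
qed

definition leading_eigenvectors ::
    "real^'n^'n \<Rightarrow> (nat \<Rightarrow> real) \<Rightarrow> real^'r::finite^'n \<Rightarrow> bool" where
  "leading_eigenvectors A lam U \<longleftrightarrow>
     (\<exists>u. ordered_eigensystem A lam u \<and> (\<forall>j. column j U = u (col_no j)))"

definition lift_eig :: "real \<Rightarrow> real \<Rightarrow> real" where
  "lift_eig m l = (if l \<ge> m then l else m)"

definition inv_sqrt_precond ::
    "real \<Rightarrow> (nat \<Rightarrow> real) \<Rightarrow> real^'r::finite^'n \<Rightarrow> real^'n^'n" where
  "inv_sqrt_precond m lam U =
     (let s = (\<lambda>i. lift_eig m (lam i) powr (- 1 / 2)); t = s (CARD('r) + 1)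
      in t *\<^sub>R mat 1 + U ** (diag_mat (\<lambda>j. s (col_no j)) - t *\<^sub>R mat 1) ** transpose U)"

definition is_inv_sqrt :: "real^'n^'n \<Rightarrow> real^'n^'n \<Rightarrow> bool" where
  "is_inv_sqrt S Q \<longleftrightarrow> pos_def S \<and> S ** S = matrix_inv Q"

definition mat_of_inv_sqrt :: "real^'n^'n \<Rightarrow> real^'n^'n" where
  "mat_of_inv_sqrt S = (THE Q. pos_def Q \<and> is_inv_sqrt S Q)"

lemma pos_def_invertible: "pos_def A \<Longrightarrow> invertible A"
  unfolding invertible_left_inverse matrix_left_invertible_ker pos_def_def
  by (metis inner_zero_right less_irrefl)

lemma matrix_inv_inverse:
  assumes "invertible (A :: real^'n^'n)"
  shows "A ** matrix_inv A = mat 1" "matrix_inv A ** A = mat 1"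
  using someI_ex[OF assms[unfolded invertible_def]] by (simp_all add: matrix_inv_def)

lemma mat_of_inv_sqrt:
  fixes S :: "real^'n^'n"
  assumes S: "pos_def S"
  shows "pos_def (mat_of_inv_sqrt S) \<and> is_inv_sqrt S (mat_of_inv_sqrt S)"
  unfolding mat_of_inv_sqrt_def
proof (rule theI)
  let ?A = "S ** S" and ?Q = "matrix_inv (S ** S)"
  have inv: "invertible ?A"
    using pos_def_invertible[OF S] by (simp add: invertible_mult)
  have sym: "transpose ?A = ?A"
    using S by (simp add: pos_def_def matrix_transpose_mul)
  have AQ: "?A ** ?Q = mat 1" "?Q ** ?A = mat 1"
    using inv by (simp_all add: matrix_inv_inverse)
  have "transpose ?Q ** ?A = mat 1"
    by (metis AQ(1) sym matrix_transpose_mul transpose_mat)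
  then have Qsym: "transpose ?Q = ?Q"
    by (metis AQ(1) matrix_mul_assoc matrix_mul_lid matrix_mul_rid)
  have "0 < v \<bullet> (?Q *v v)" if "v \<noteq> 0" for v
  proof -
    define w where "w = ?Q *v v"
    have v: "v = S *v (S *v w)"
      by (simp add: w_def matrix_vector_mul_assoc matrix_mul_assoc AQ(1)[unfolded matrix_mul_assoc])
    have "v \<bullet> w = (S *v w) \<bullet> (S *v w)"
      by (metis S v dot_lmul_matrix transpose_matrix_vector pos_def_def)
    moreover have "S *v w \<noteq> 0"
      using that v by auto
    ultimately show ?thesis
      by (simp add: w_def)
  qed
  then have Q: "pos_def ?Q"
    using Qsym by (simp add: pos_def_def)
  have "?A = matrix_inv ?Q"
    by (metis AQ(1) matrix_inv_inverse(1) pos_def_invertible[OF Q] matrix_mul_assoc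
        matrix_mul_lid matrix_mul_rid)
  with Q S show "pos_def ?Q \<and> is_inv_sqrt S ?Q"
    by (simp add: is_inv_sqrt_def)
  fix Q assume "pos_def Q \<and> is_inv_sqrt S Q"
  then have "?A ** Q = mat 1"
    by (simp add: is_inv_sqrt_def matrix_inv_inverse pos_def_invertible)
  then show "Q = ?Q"
    by (metis AQ(2) matrix_mul_assoc matrix_mul_lid matrix_mul_rid)
qed

text \<open>Logarithm on \<open>[0, \<infinity>)\<close> with \<open>log 0 = -\<infinity>\<close>, whereas \<open>ln 0 = 0\<close> for the library's \<open>ln\<close>.\<close>

definition ext_ln :: "real \<Rightarrow> ereal" where
  "ext_ln y = (if y = 0 then -\<infinity> else ereal (ln y))"

end

theory Submission
  imports Defs
begin

text \<open>
  The iteration is gradient descent in a metric that varies boundedly. The preconditioner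
  \<open>S = Q\<^sup>-\<^sup>1\<^sup>/\<^sup>2\<close> is positive definite (\<open>pos_def_inv_sqrt_precond\<close>), so the bounds
  \<open>m I \<preceq> Q \<preceq> M I\<close> transfer to \<open>M\<^sup>-\<^sup>1\<^sup>/\<^sup>2 I \<preceq> S\<close> (\<open>inv_sqrt_lower_bound\<close>) and to
  \<open>S\<^sup>2 \<preceq> m\<^sup>-\<^sup>1\<^sup>/\<^sup>2 S\<close> (\<open>inv_sqrt_upper_bound\<close>).

  Let \<open>g\<close> be the gradient at \<open>x\<close> and \<open>t = m / (L \<surd>M)\<close> the step size. The quadratic upper bound
  given by the Lipschitz gradient (\<open>lipschitz_gradient_upper_bound\<close>) shows that a step decreases
  \<open>f\<close> by at least \<open>t \<langle>g, S g\<rangle> - L t\<^sup>2 |S g|\<^sup>2 / 2\<close>. By \<open>S\<^sup>2 \<preceq> m\<^sup>-\<^sup>1\<^sup>/\<^sup>2 S\<close> this is at least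
  \<open>t (1 - \<surd>(m/M) / 2) \<langle>g, S g\<rangle>\<close>, hence at least \<open>t \<langle>g, S g\<rangle> / 2\<close> because \<open>m \<le> M\<close>, and then at
  least \<open>m |g|\<^sup>2 / (2 L M)\<close> by the lower bound on \<open>S\<close>. Strong convexity bounds the optimality
  gap by \<open>|g|\<^sup>2 / (2 \<mu>)\<close> (\<open>strongly_convex_gap_le_gradient\<close>), so each step contracts the gap by
  \<open>c = 1 - \<mu> m / (L M)\<close>, which lies in \<open>(0, 1)\<close> since \<open>\<mu> < L\<close> and \<open>m \<le> M\<close>. The iteration count
  is the logarithm of \<open>c\<^sup>k (f(x\<^sub>0) - f(x\<^sup>*)) \<le> \<epsilon>\<close>.
\<close>

section \<open>Smooth and strongly convex functions\<close>

text \<open>Along the segment from \<open>y\<close> to \<open>z\<close>, the function minus the claimed quadratic bound has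
  nonpositive derivative, by Cauchy-Schwarz and the Lipschitz condition.\<close>

lemma lipschitz_gradient_upper_bound:
  fixes f :: "'a::real_inner \<Rightarrow> real"
  assumes grad: "\<And>y. GDERIV f y :> grad y"
    and lip: "lipschitz_on L UNIV grad"
  shows "f z \<le> f y + grad y \<bullet> (z - y) + L / 2 * (norm (z - y))\<^sup>2"
proof -
  define h where "h = z - y"
  define \<phi> where "\<phi> = (\<lambda>t. f (y + t *\<^sub>R h) - t * (grad y \<bullet> h) - L / 2 * t\<^sup>2 * (norm h)\<^sup>2)"
  have D: "(\<phi> has_real_derivative
      (h \<bullet> grad (y + t *\<^sub>R h) - grad y \<bullet> h - L * t * (norm h)\<^sup>2)) (at t)" for t
  proof -
    have "((\<lambda>t. y + t *\<^sub>R h) has_derivative (\<lambda>s. s *\<^sub>R h)) (at t)"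
      by (auto intro!: derivative_eq_intros)
    then have "((\<lambda>t. f (y + t *\<^sub>R h)) has_derivative (\<lambda>s. (s *\<^sub>R h) \<bullet> grad (y + t *\<^sub>R h))) (at t)"
      using has_derivative_compose grad[of "y + t *\<^sub>R h", unfolded gderiv_def] by blast
    then have "((\<lambda>t. f (y + t *\<^sub>R h)) has_real_derivative h \<bullet> grad (y + t *\<^sub>R h)) (at t)"
      by (simp add: has_field_derivative_def mult_commute_abs)
    then show ?thesis
      unfolding \<phi>_def by (auto intro!: derivative_eq_intros)
  qed
  have "\<phi> 1 \<le> \<phi> 0"
  proof (rule DERIV_nonpos_imp_nonincreasing[of 0 1 \<phi>])
    fix t :: real assume t: "0 \<le> t" "t \<le> 1"
    have "h \<bullet> grad (y + t *\<^sub>R h) - grad y \<bullet> h = (grad (y + t *\<^sub>R h) - grad y) \<bullet> h"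
      by (simp add: inner_diff_left inner_commute[of h])
    also have "\<dots> \<le> norm (grad (y + t *\<^sub>R h) - grad y) * norm h"
      by (rule norm_cauchy_schwarz)
    also have "\<dots> \<le> (L * norm (t *\<^sub>R h)) * norm h"
      using lipschitz_onD[OF lip, of "y + t *\<^sub>R h" y]
      by (intro mult_right_mono) (simp_all add: dist_norm)
    also have "\<dots> = L * t * (norm h)\<^sup>2"
      using t by (simp add: power2_eq_square)
    finally show "\<exists>D. DERIV \<phi> t :> D \<and> D \<le> 0"
      using D[of t] by (intro exI[of _ "h \<bullet> grad (y + t *\<^sub>R h) - grad y \<bullet> h - L * t * (norm h)\<^sup>2"]) simp
  qed simp
  then show ?thesis
    by (simp add: \<phi>_def h_def)
qed

text \<open>The Polyak-Lojasiewicz inequality: the minimum over \<open>z\<close> of the quadratic minorant of \<open>f\<close>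
  at \<open>y\<close> is \<open>f y - |grad y|\<^sup>2 / (2 \<mu>)\<close>, as one sees by completing the square.\<close>

lemma strongly_convex_gap_le_gradient:
  fixes f :: "'a::real_inner \<Rightarrow> real"
  assumes sc: "strongly_convex \<mu> f grad" and "0 < \<mu>"
  shows "2 * \<mu> * (f y - f z) \<le> (norm (grad y))\<^sup>2"
proof -
  have "f y - f z \<le> - (grad y \<bullet> (z - y)) - \<mu> / 2 * (norm (z - y))\<^sup>2"
    using sc[unfolded strongly_convex_def, rule_format, where x = y and y = z] by linarith
  then have "2 * \<mu> * (f y - f z) \<le> 2 * \<mu> * (- (grad y \<bullet> (z - y)) - \<mu> / 2 * (norm (z - y))\<^sup>2)"
    using \<open>0 < \<mu>\<close> by (intro mult_left_mono) simp_all
  also have "\<dots> = (norm (grad y))\<^sup>2 - (norm (grad y + \<mu> *\<^sub>R (z - y)))\<^sup>2"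
    unfolding power2_norm_eq_inner
    by (simp add: inner_commute algebra_simps power2_eq_square)
  also have "\<dots> \<le> (norm (grad y))\<^sup>2"
    by simp
  finally show ?thesis .
qed

section \<open>Positive definite matrices and inverse square roots\<close>

lemma transpose_eq_inner_commute:
  fixes S :: "real^'n^'n"
  assumes "transpose S = S"
  shows "(S *v v) \<bullet> w = v \<bullet> (S *v w)"
  by (metis assms dot_lmul_matrix transpose_matrix_vector)

text \<open>Cauchy-Schwarz for the inner product \<open>\<langle>v, S w\<rangle>\<close>: the form is nonnegative at the
  combination of \<open>v\<close> and \<open>w\<close> that is orthogonal to \<open>w\<close>.\<close>

lemma pos_def_cauchy_schwarz:
  fixes S :: "real^'n^'n"
  assumes S: "pos_def S"
  shows "(v \<bullet> (S *v w))\<^sup>2 \<le> (v \<bullet> (S *v v)) * (w \<bullet> (S *v w))"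
proof (cases "w = 0")
  case False
  define a b c where "a = v \<bullet> (S *v v)" and "b = v \<bullet> (S *v w)" and "c = w \<bullet> (S *v w)"
  have sym: "transpose S = S"
    using S by (simp add: pos_def_def)
  have c: "0 < c"
    using S False by (simp add: pos_def_def c_def)
  have b': "w \<bullet> (S *v v) = b"
    unfolding b_def by (metis transpose_eq_inner_commute[OF sym] inner_commute)
  define q where "q = c *\<^sub>R v - b *\<^sub>R w"
  have "0 \<le> q \<bullet> (S *v q)"
    using S by (cases "q = 0") (auto simp: pos_def_def less_imp_le)
  also have "q \<bullet> (S *v q) = c * (c * a - b * b)"
    by (simp add: q_def matrix_vector_mult_diff_distrib matrix_vector_mult_scaleR
        inner_diff_left inner_diff_right b' algebra_simps
        flip: a_def b_def c_def)
  finally show ?thesis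
    using c by (simp add: zero_le_mult_iff power2_eq_square mult.commute[of a]
        flip: a_def b_def c_def)
qed simp

text \<open>With \<open>w = S (S z)\<close> the form \<open>\<langle>w, Q w\<rangle>\<close> becomes \<open>|S z|\<^sup>2\<close>, so bounds on \<open>Q\<close> are bounds of
  \<open>|S (S z)|\<close> by \<open>|S z|\<close>. Every vector is of the form \<open>S z\<close>.\<close>

lemma inv_sqrt_norm_bounds:
  fixes S Q :: "real^'n^'n"
  assumes S: "pos_def S" and Q: "pos_def Q" and SQ: "is_inv_sqrt S Q"
    and lower: "m *\<^sub>R mat 1 \<preceq>\<^sub>L Q" and upper: "Q \<preceq>\<^sub>L M *\<^sub>R mat 1"
  shows "m * (norm (S *v v))\<^sup>2 \<le> (norm v)\<^sup>2"
    and "(norm v)\<^sup>2 \<le> M * (norm (S *v v))\<^sup>2"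
proof -
  have sym: "transpose S = S"
    using S by (simp add: pos_def_def)
  obtain z where z: "v = S *v z"
    by (metis S matrix_inv_inverse(1) matrix_vector_mul_assoc matrix_vector_mul_lid
        pos_def_invertible)
  define w where "w = S *v v"
  have w: "w = matrix_inv Q *v z"
    using SQ by (simp add: w_def z is_inv_sqrt_def matrix_vector_mul_assoc)
  have "Q *v w = z"
    by (simp add: w matrix_vector_mul_assoc matrix_inv_inverse pos_def_invertible[OF Q])
  then have form: "w \<bullet> (Q *v w) = (norm v)\<^sup>2"
    by (simp add: w_def z transpose_eq_inner_commute[OF sym] power2_norm_eq_inner)
  have eye: "(a *\<^sub>R mat 1) *v w = a *\<^sub>R w" for a :: real
    by (metis matrix_vector_mul_lid scaleR_matrix_vector_assoc)
  show "m * (norm (S *v v))\<^sup>2 \<le> (norm v)\<^sup>2"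
    using lower unfolding loewner_le_def pos_semidef_def
    by (auto dest!: spec[of _ w] simp: matrix_vector_mult_diff_rdistrib eye inner_diff_right form
        power2_norm_eq_inner simp flip: w_def)
  show "(norm v)\<^sup>2 \<le> M * (norm (S *v v))\<^sup>2"
    using upper unfolding loewner_le_def pos_semidef_def
    by (auto dest!: spec[of _ w] simp: matrix_vector_mult_diff_rdistrib eye inner_diff_right form
        power2_norm_eq_inner simp flip: w_def)
qed

text \<open>The norm bound \<open>|S v| \<le> m\<^sup>-\<^sup>1\<^sup>/\<^sup>2 |v|\<close> yields \<open>S\<^sup>2 \<preceq> m\<^sup>-\<^sup>1\<^sup>/\<^sup>2 S\<close> without diagonalising \<open>S\<close>:
  Cauchy-Schwarz for \<open>S\<close> at \<open>v\<close> and \<open>S v\<close> bounds \<open>|S v|\<^sup>4\<close> by \<open>\<langle>v, S v\<rangle> |S v| |S (S v)|\<close>.\<close>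

lemma inv_sqrt_upper_bound:
  fixes S Q :: "real^'n^'n"
  assumes S: "pos_def S" and Q: "pos_def Q" and SQ: "is_inv_sqrt S Q"
    and lower: "m *\<^sub>R mat 1 \<preceq>\<^sub>L Q" and upper: "Q \<preceq>\<^sub>L M *\<^sub>R mat 1" and "0 < m"
  shows "sqrt m * (norm (S *v v))\<^sup>2 \<le> v \<bullet> (S *v v)"
proof (cases "S *v v = 0")
  case False
  define w where "w = S *v v"
  have sym: "transpose S = S"
    using S by (simp add: pos_def_def)
  have "v \<noteq> 0"
    using False by auto
  then have vSv: "0 \<le> v \<bullet> w"
    using S by (simp add: pos_def_def w_def less_imp_le)
  have "sqrt (m * (norm (S *v w))\<^sup>2) \<le> sqrt ((norm w)\<^sup>2)"
    by (intro real_sqrt_le_mono inv_sqrt_norm_bounds(1)[OF S Q SQ lower upper])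
  then have nw: "sqrt m * norm (S *v w) \<le> norm w"
    by (simp add: real_sqrt_mult)
  have "((norm w)\<^sup>2)\<^sup>2 = (v \<bullet> (S *v w))\<^sup>2"
    by (simp add: power2_norm_eq_inner w_def transpose_eq_inner_commute[OF sym])
  also have "\<dots> \<le> (v \<bullet> w) * (w \<bullet> (S *v w))"
    unfolding w_def by (rule pos_def_cauchy_schwarz[OF S])
  also have "\<dots> \<le> (v \<bullet> w) * (norm w * norm (S *v w))"
    by (intro mult_left_mono norm_cauchy_schwarz vSv)
  finally have "sqrt m * ((norm w)\<^sup>2)\<^sup>2 \<le> sqrt m * ((v \<bullet> w) * (norm w * norm (S *v w)))"
    using \<open>0 < m\<close> by (intro mult_left_mono) simp_all
  also have "\<dots> = ((v \<bullet> w) * norm w) * (sqrt m * norm (S *v w))"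
    by (simp add: ac_simps)
  also have "\<dots> \<le> ((v \<bullet> w) * norm w) * norm w"
    using vSv by (intro mult_left_mono nw) simp
  finally have "(norm w)\<^sup>2 * (sqrt m * (norm w)\<^sup>2) \<le> (norm w)\<^sup>2 * (v \<bullet> w)"
    by (simp add: power2_eq_square ac_simps)
  then show ?thesis
    unfolding w_def by (rule mult_left_le_imp_le) (use False in simp)
qed simp

text \<open>Dually, \<open>M\<^sup>-\<^sup>1\<^sup>/\<^sup>2 I \<preceq> S\<close> follows from Cauchy-Schwarz for \<open>S\<close> at \<open>v\<close> and \<open>S\<^sup>-\<^sup>1 v\<close>, which bounds
  \<open>|v|\<^sup>4\<close> by \<open>\<langle>v, S v\<rangle> |S\<^sup>-\<^sup>1 v| |v|\<close>.\<close>

lemma inv_sqrt_lower_bound: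
  fixes S Q :: "real^'n^'n"
  assumes S: "pos_def S" and Q: "pos_def Q" and SQ: "is_inv_sqrt S Q"
    and lower: "m *\<^sub>R mat 1 \<preceq>\<^sub>L Q" and upper: "Q \<preceq>\<^sub>L M *\<^sub>R mat 1"
  shows "(norm v)\<^sup>2 \<le> sqrt M * (v \<bullet> (S *v v))"
proof (cases "v = 0")
  case False
  obtain z where z: "S *v z = v"
    by (metis S matrix_inv_inverse(1) matrix_vector_mul_assoc matrix_vector_mul_lid
        pos_def_invertible)
  have vSv: "0 \<le> v \<bullet> (S *v v)"
    using S False by (simp add: pos_def_def less_imp_le)
  have "sqrt ((norm z)\<^sup>2) \<le> sqrt (M * (norm v)\<^sup>2)"
    using inv_sqrt_norm_bounds(2)[OF S Q SQ lower upper, of z]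
    by (intro real_sqrt_le_mono) (simp add: z)
  then have nz: "norm z \<le> sqrt M * norm v"
    by (simp add: real_sqrt_mult)
  have "((norm v)\<^sup>2)\<^sup>2 = (v \<bullet> (S *v z))\<^sup>2"
    by (simp add: power2_norm_eq_inner z)
  also have "\<dots> \<le> (v \<bullet> (S *v v)) * (z \<bullet> v)"
    using pos_def_cauchy_schwarz[OF S, of v z] by (simp add: z)
  also have "\<dots> \<le> (v \<bullet> (S *v v)) * (norm z * norm v)"
    by (intro mult_left_mono norm_cauchy_schwarz vSv)
  also have "\<dots> \<le> (v \<bullet> (S *v v)) * ((sqrt M * norm v) * norm v)"
    by (intro mult_left_mono mult_right_mono nz vSv) simp
  finally have "(norm v)\<^sup>2 * (norm v)\<^sup>2 \<le> (norm v)\<^sup>2 * (sqrt M * (v \<bullet> (S *v v)))"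
    by (simp add: power2_eq_square ac_simps)
  then show ?thesis
    by (rule mult_left_le_imp_le) (use False in simp)
qed simp

section \<open>The truncated preconditioner\<close>

lemma leading_eigenvectors_orthonormal:
  fixes U :: "real^'r::finite^'n"
  assumes "leading_eigenvectors A lam U" and "CARD('r) \<le> CARD('n)"
  shows "transpose U ** U = mat 1"
proof -
  obtain u where u: "ordered_eigensystem A lam u" and col: "\<And>j. column j U = u (col_no j)"
    using assms(1) by (auto simp: leading_eigenvectors_def)
  have ran: "col_no j \<in> {1..CARD('n)}" for j :: 'r
    using bij_betw_apply[OF bij_betw_col_no, of j] assms(2) by auto
  have inj: "col_no i = col_no j \<longleftrightarrow> i = j" for i j :: 'r
    using bij_betw_imp_inj_on[OF bij_betw_col_no] by (auto simp: inj_on_def)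
  have "column i U \<bullet> column j U = (if i = j then 1 else 0)" for i j
    using u ran[of i] ran[of j] inj[of i j] by (simp add: col ordered_eigensystem_def)
  then show ?thesis
    by (simp add: vec_eq_iff matrix_matrix_mult_def transpose_def column_def inner_vec_def mat_def)
qed

lemma diag_mat_vector: "diag_mat e *v w = (\<chi> j. e j * w $ j)"
  by (simp add: vec_eq_iff matrix_vector_mult_def diag_mat_def if_distrib [of "\<lambda>a. a * _"]
      cong: if_cong)

text \<open>Writing \<open>w = U\<^sup>T v\<close>, the columns of \<open>U\<close> being orthonormal splits the quadratic form at \<open>v\<close>
  into \<open>t |v - U w|\<^sup>2\<close> and a weighted sum of squares of the coordinates of \<open>w\<close>. The factor \<open>t\<close> and
  the weights are inverse square roots of lifted eigenvalues, hence positive, and both parts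
  vanish only if \<open>v = 0\<close>.\<close>

lemma pos_def_inv_sqrt_precond:
  fixes U :: "real^'r::finite^'n"
  assumes orth: "transpose U ** U = mat 1" and "0 < m"
  shows "pos_def (inv_sqrt_precond m lam U)"
proof -
  define s where "s = (\<lambda>i. lift_eig m (lam i) powr (- 1 / 2))"
  define t where "t = s (CARD('r) + 1)"
  define e where "e = (\<lambda>j :: 'r. s (col_no j))"
  define S where "S = inv_sqrt_precond m lam U"
  have S: "S = t *\<^sub>R mat 1 + U ** (diag_mat e - t *\<^sub>R mat 1) ** transpose U"
    by (simp add: S_def inv_sqrt_precond_def Let_def s_def t_def e_def)
  have s_pos: "0 < s i" for i
    using \<open>0 < m\<close> by (simp add: s_def lift_eig_def)
  have "transpose (diag_mat e - t *\<^sub>R mat 1) = diag_mat e - t *\<^sub>R mat 1"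
    by (simp add: vec_eq_iff transpose_def diag_mat_def mat_def)
  then have "transpose (U ** (diag_mat e - t *\<^sub>R mat 1) ** transpose U)
      = U ** (diag_mat e - t *\<^sub>R mat 1) ** transpose U"
    by (simp add: matrix_transpose_mul matrix_mul_assoc)
  moreover have "transpose (A + B) = transpose A + transpose B" for A B :: "real^'n^'n"
    by (simp add: vec_eq_iff transpose_def)
  moreover have "transpose (t *\<^sub>R mat 1 :: real^'n^'n) = t *\<^sub>R mat 1"
    by (simp add: vec_eq_iff transpose_def mat_def)
  ultimately have sym: "transpose S = S"
    by (simp add: S)
  have "0 < v \<bullet> (S *v v)" if "v \<noteq> 0" for v
  proof -
    define w where "w = transpose U *v v"
    define q where "q = v - U *v w"
    have eye: "(t *\<^sub>R mat 1) *v y = t *\<^sub>R y" for y :: "real^'k"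
      by (metis matrix_vector_mul_lid scaleR_matrix_vector_assoc)
    have adj: "y \<bullet> (U *v z) = (transpose U *v y) \<bullet> z" for y z
      by (metis dot_lmul_matrix transpose_matrix_vector)
    have "S *v v = t *\<^sub>R v + U *v (diag_mat e *v w - t *\<^sub>R w)"
      by (simp add: S w_def eye matrix_vector_mult_add_rdistrib matrix_vector_mult_diff_rdistrib
          flip: matrix_vector_mul_assoc)
    also have "\<dots> = t *\<^sub>R q + U *v (diag_mat e *v w)"
      by (simp add: q_def matrix_vector_mult_diff_distrib matrix_vector_mult_scaleR
          scaleR_diff_right)
    finally have "v \<bullet> (S *v v) = t * (v \<bullet> q) + w \<bullet> (diag_mat e *v w)"
      by (simp add: inner_add_right adj w_def)
    also have "v \<bullet> q = q \<bullet> q"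
    proof -
      have "transpose U *v q = 0"
        by (simp add: q_def matrix_vector_mult_diff_distrib matrix_vector_mul_assoc orth)
          (simp add: w_def)
      then have "q \<bullet> (U *v w) = 0"
        by (simp add: adj)
      then have "(q + U *v w) \<bullet> q = q \<bullet> q"
        by (simp only: inner_add_left inner_commute[of "U *v w" q] add_0_right)
      moreover have "q + U *v w = v"
        by (simp add: q_def)
      ultimately show ?thesis
        by (simp only:)
    qed
    also have "w \<bullet> (diag_mat e *v w) = (\<Sum>j\<in>UNIV. e j * (w $ j)\<^sup>2)"
      by (simp add: diag_mat_vector inner_vec_def power2_eq_square ac_simps)
    finally have form: "v \<bullet> (S *v v) = t * (q \<bullet> q) + (\<Sum>j\<in>UNIV. e j * (w $ j)\<^sup>2)" .
    have t_pos: "0 < t" and e_pos: "0 < e j" for j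
      using s_pos by (simp_all add: t_def e_def)
    have sum_ge: "0 \<le> (\<Sum>j\<in>UNIV. e j * (w $ j)\<^sup>2)"
      using e_pos by (intro sum_nonneg) (simp add: less_imp_le)
    show ?thesis
    proof (cases "q = 0")
      case True
      then have "w \<noteq> 0"
        using that by (auto simp: q_def)
      then obtain i where "w $ i \<noteq> 0"
        by (auto simp: vec_eq_iff)
      then have "0 < (\<Sum>j\<in>UNIV. e j * (w $ j)\<^sup>2)"
        using e_pos by (intro sum_pos2[of _ i]) (simp_all add: less_imp_le)
      then show ?thesis
        by (simp add: form True)
    next
      case False
      then show ?thesis
        using t_pos sum_ge by (simp add: form add_pos_nonneg)
    qed
  qed
  with sym show ?thesis
    by (simp add: pos_def_def flip: S_def)
qed

section \<open>Linear convergence\<close>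

text \<open>The step size \<open>m / (L \<surd>M)\<close> is at most \<open>\<surd>m / L\<close>, the inverse of a Lipschitz constant of
  the gradient in the metric of \<open>S\<^sup>-\<^sup>1\<close>, so at least half of the first-order decrease survives.\<close>

lemma preconditioned_step_decrease:
  fixes f :: "real^'n \<Rightarrow> real" and S Q :: "real^'n^'n"
  assumes grad: "\<And>y. GDERIV f y :> grad y" and lip: "lipschitz_on L UNIV grad"
    and S: "pos_def S" and Q: "pos_def Q" and SQ: "is_inv_sqrt S Q"
    and lower: "m *\<^sub>R mat 1 \<preceq>\<^sub>L Q" and upper: "Q \<preceq>\<^sub>L M *\<^sub>R mat 1"
    and "0 < m" and "m \<le> M" and "0 < L"
  shows "f (y - (m / (L * sqrt M)) *\<^sub>R (S *v grad y)) \<le> f y - m / (2 * L * M) * (norm (grad y))\<^sup>2"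
proof -
  define t where "t = m / (L * sqrt M)"
  define p where "p = grad y \<bullet> (S *v grad y)"
  have M: "0 < M" and t: "0 < t"
    using assms(8-10) by (simp_all add: t_def)
  have gp: "(norm (grad y))\<^sup>2 \<le> sqrt M * p"
    unfolding p_def by (rule inv_sqrt_lower_bound[OF S Q SQ lower upper])
  have Sg: "sqrt m * (norm (S *v grad y))\<^sup>2 \<le> p"
    unfolding p_def by (rule inv_sqrt_upper_bound[OF S Q SQ lower upper \<open>0 < m\<close>])
  have "L * t = sqrt m * (sqrt m / sqrt M)"
    using \<open>0 < L\<close> \<open>0 < m\<close> by (simp add: t_def)
  also have "\<dots> \<le> sqrt m * 1"
    using \<open>0 < m\<close> \<open>m \<le> M\<close> M by (intro mult_left_mono) (simp_all add: divide_le_eq_1)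
  finally have "L * t * (norm (S *v grad y))\<^sup>2 \<le> sqrt m * (norm (S *v grad y))\<^sup>2"
    by (intro mult_right_mono) simp_all
  with Sg have Lt: "L * t * (norm (S *v grad y))\<^sup>2 \<le> p"
    by linarith
  have "f (y - t *\<^sub>R (S *v grad y)) \<le> f y - t * p + L / 2 * (t * norm (S *v grad y))\<^sup>2"
    using lipschitz_gradient_upper_bound[OF grad lip, of "y - t *\<^sub>R (S *v grad y)" y] t
    by (simp add: p_def)
  also have "\<dots> = f y - t * p + t / 2 * (L * t * (norm (S *v grad y))\<^sup>2)"
    by (simp add: power2_eq_square)
  also have "\<dots> \<le> f y - t * p + t / 2 * p"
    using t by (intro add_left_mono mult_left_mono Lt) simp
  also have "\<dots> = f y - m / (2 * L * M) * (sqrt M * p)"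
    using M \<open>0 < L\<close> by (simp add: t_def field_simps)
  also have "\<dots> \<le> f y - m / (2 * L * M) * (norm (grad y))\<^sup>2"
    using M \<open>0 < L\<close> \<open>0 < m\<close> by (intro diff_left_mono mult_left_mono gp) simp
  finally show ?thesis
    by (simp add: t_def)
qed

text \<open>For \<open>a 0 > 0\<close> this is the logarithm of \<open>c\<^sup>k a 0 \<le> \<epsilon>\<close>. For \<open>a 0 = 0\<close>, where \<open>ext_ln\<close> is
  \<open>-\<infinity>\<close>, the contraction keeps every \<open>a k\<close> at most \<open>0\<close>.\<close>

lemma iteration_count_of_contraction:
  fixes a :: "nat \<Rightarrow> real"
  assumes c: "0 < c" "c < 1" and nonneg: "0 \<le> a 0"
    and contr: "\<And>k. a (Suc k) \<le> c * a k" and "0 < \<epsilon>"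
    and k: "ext_ln (a 0 / \<epsilon>) / ereal (ln (1 / c)) \<le> ereal (real k)"
  shows "a k \<le> \<epsilon>"
proof -
  have "a j \<le> c ^ j * a 0" for j
  proof (induction j)
    case (Suc j)
    have "a (Suc j) \<le> c * (c ^ j * a 0)"
      using contr[of j] mult_left_mono[OF Suc, of c] c by linarith
    then show ?case by simp
  qed simp
  then have ak: "a k \<le> c ^ k * a 0" .
  show ?thesis
  proof (cases "a 0 = 0")
    case True
    then show ?thesis using ak \<open>0 < \<epsilon>\<close> by simp
  next
    case False
    with nonneg have a0: "0 < a 0" by simp
    have ln_pos: "0 < ln (1 / c)"
      using c by (simp add: ln_div)
    have "ln (a 0 / \<epsilon>) / ln (1 / c) \<le> real k"
      using k a0 \<open>0 < \<epsilon>\<close> ln_pos by (simp add: ext_ln_def)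
    then have "ln (a 0 / \<epsilon>) \<le> real k * ln (1 / c)"
      using ln_pos by (simp add: pos_divide_le_eq)
    also have "\<dots> = ln ((1 / c) ^ k)"
      using c by (simp add: ln_realpow)
    finally have "a 0 / \<epsilon> \<le> (1 / c) ^ k"
      using a0 \<open>0 < \<epsilon>\<close> c by (subst (asm) ln_le_cancel_iff) simp_all
    then have "c ^ k * a 0 \<le> \<epsilon>"
      using \<open>0 < \<epsilon>\<close> c by (simp add: field_simps power_divide)
    with ak show ?thesis by linarith
  qed
qed

theorem theorem3p5:
  fixes f :: "real^'n \<Rightarrow> real"
    and grad :: "real^'n \<Rightarrow> real^'n"
    and x\<^sub>s :: "real^'n"
    and R :: "real^'n^'l"
    and P :: "real^'l^'n"
    and \<mu> L m M :: real
    and x d :: "nat \<Rightarrow> real^'n"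
    and lam :: "nat \<Rightarrow> nat \<Rightarrow> real"
    and U :: "nat \<Rightarrow> real^'r^'n"
    and S :: "nat \<Rightarrow> real^'n^'n"
  assumes "0 < \<mu>" and "\<mu> < L"
    and "\<And>y. GDERIV f y :> grad y"
    and "lipschitz_on L UNIV grad"
    and "strongly_convex \<mu> f grad"
    and "\<And>y. f x\<^sub>s \<le> f y"
    and "CARD('l) < CARD('n)"
    and "P = transpose R"
    and "rank P = CARD('l)"
    and "0 < m"
    and "CARD('r) + 1 \<le> CARD('n)"
    and "\<And>k. leading_eigenvectors (outer_square (grad (x k))) (lam k) (U k)"
    and "\<And>k. S k = inv_sqrt_precond m (lam k) (U k)"
    and "\<And>k. d k = - (S k *v grad (x k))"
    and "\<And>k. x (Suc k) = x k + (m / (L * sqrt M)) *\<^sub>R d k"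
    and "m \<le> M"
    and "\<And>k. m *\<^sub>R mat 1 \<preceq>\<^sub>L mat_of_inv_sqrt (S k)"
    and "\<And>k. mat_of_inv_sqrt (S k) \<preceq>\<^sub>L M *\<^sub>R mat 1"
  shows "\<exists>c. 0 < c \<and> c < 1 \<and>
    (\<forall>k. f (x (Suc k)) - f x\<^sub>s \<le> c * (f (x k) - f x\<^sub>s)) \<and>
    (\<forall>\<epsilon>>0. let K = ext_ln ((f (x 0) - f x\<^sub>s) / \<epsilon>) / ereal (ln (1 / c))
       in \<forall>k::nat. max 0 K \<le> ereal (real k) \<longrightarrow> f (x k) - f x\<^sub>s \<le> \<epsilon>)"
proof -
  define c where "c = 1 - \<mu> * m / (L * M)"
  have L: "0 < L" and M: "0 < M"
    using assms(1,2,10,16) by simp_all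
  have "\<mu> * m < L * M"
    using assms(1,2,10,16) by (intro mult_less_le_imp_less) simp_all
  then have c: "0 < c" "c < 1"
    using L M assms(1,10) by (simp_all add: c_def)
  have contr: "f (x (Suc k)) - f x\<^sub>s \<le> c * (f (x k) - f x\<^sub>s)" for k
  proof -
    define Q where "Q = mat_of_inv_sqrt (S k)"
    have "transpose (U k) ** U k = mat 1"
      using leading_eigenvectors_orthonormal[OF assms(12)] assms(11) by simp
    then have S: "pos_def (S k)"
      unfolding assms(13) by (rule pos_def_inv_sqrt_precond[OF _ assms(10)])
    then have Q: "pos_def Q" "is_inv_sqrt (S k) Q"
      unfolding Q_def by (simp_all add: mat_of_inv_sqrt)
    have "f (x (Suc k)) \<le> f (x k) - m / (2 * L * M) * (norm (grad (x k)))\<^sup>2"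
      using preconditioned_step_decrease[OF assms(3,4) S Q, of m M "x k"] assms(10,14-18) L
      by (simp add: Q_def)
    \<comment> \<open>The gap inequality bounds the squared gradient norm below by a multiple of the gap itself.\<close>
    moreover have "m / (2 * L * M) * (2 * \<mu> * (f (x k) - f x\<^sub>s))
        \<le> m / (2 * L * M) * (norm (grad (x k)))\<^sup>2"
      using L M assms(10)
      by (intro mult_left_mono strongly_convex_gap_le_gradient[OF assms(5,1)]) simp
    moreover have "m / (2 * L * M) * (2 * \<mu> * (f (x k) - f x\<^sub>s)) = (1 - c) * (f (x k) - f x\<^sub>s)"
      by (simp add: c_def)
    ultimately show ?thesis
      by (simp add: left_diff_distrib)
  qed
  have "f (x k) - f x\<^sub>s \<le> \<epsilon>"
    if "0 < \<epsilon>" "ext_ln ((f (x 0) - f x\<^sub>s) / \<epsilon>) / ereal (ln (1 / c)) \<le> ereal (real k)" for \<epsilon> k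
    using iteration_count_of_contraction[of c "\<lambda>k. f (x k) - f x\<^sub>s" \<epsilon> k] c contr that assms(6)
    by simp
  with c contr show ?thesis
    by (intro exI[of _ c]) (simp add: Let_def)
qed

end
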